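(* Let $z^\star\in\mathbb{T}^n$, let $\Delta\in\mathbb{C}^{n\times n}$ be a Hermitian matrix with zero diagonal, and let $C=(z^\star)(z^\star)^H+\Delta$. Suppose that (i) $\|\Delta\|_{\rm op}\le\frac{n^{2/3}}{32768}$ and $\|\Delta z^\star\|_\infty\le\frac{n}{24}$, and (ii) the parameter $\alpha$ satisfies $\alpha\ge4$. Let $\tilde C=C+\frac{n}{\alpha}I$, and for $z\in\mathbb{T}^n$ define $$ \Sigma(z)={\rm Diag}(|\tilde Cz|)-\tilde C,\qquad \rho(z)=\|\Sigma(z)z\|_2=\left\|\left({\rm Diag}(|\tilde Cz|)-\tilde C\right)z\right\|_2. $$ Then, for any point $z\in\mathbb{T}^n$ satisfying $d_2(z,z^\star)\le\frac{\sqrt n}{2}$ and any second-order critical point $\tilde z\in\mathbb{T}^n$ of the problem $\max_{w\in\mathbb{T}^n}w^HCw$, we have $$ d_2(z,\tilde z)\le\frac{8}{n}\rho(z). $$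
   Context: $\mathbb{T}^n=\{w\in\mathbb{C}^n: |w_1|=\cdots=|w_n|=1\}$; $(\cdot)^H$ is the Hermitian transpose; $\|\cdot\|_{\rm op}$ is the operator norm. For $v\in\mathbb{C}^n$, $|v|$ is the vector of entrywise moduli and ${\rm Diag}(v)$ is the diagonal matrix with diagonal $v$; for a matrix $M$, ${\rm diag}(M)$ is the vector of its diagonal entries. For $w,z\in\mathbb{T}^n$, $d_2(w,z)=\min_{\theta\in[0,2\pi)}\|w-e^{i\theta}z\|_2$. Second-order critical point: for $z\in\mathbb{T}^n$ let $S(z)=\Re\{{\rm Diag}({\rm diag}(Czz^H))\}-C$ and let $T_z\mathbb{T}^n=\{w\in\mathbb{C}^n:\Re\{w_i\bar z_i\}=0,\ i=1,\dots,n\}$ be the tangent space to $\mathbb{T}^n$ at $z$. A point $\tilde z\in\mathbb{T}^n$ is a second-order critical point of $\max_{w\in\mathbb{T}^n}w^HCw$ if it is first-order critical, i.e. $S(\tilde z)\tilde z=0$, and $w^HS(\tilde z)w\ge0$ for all $w\in T_{\tilde z}\mathbb{T}^n$. *)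

theory Defs
  imports "HOL-Analysis.Analysis"
begin

definition torus :: "(complex ^ 'n) set" where
  "torus = {w. \<forall>i. cmod (w $ i) = 1}"

definition hermitian :: "complex ^ 'n ^ 'n \<Rightarrow> bool" where
  "hermitian A \<longleftrightarrow> (\<forall>i j. A $ i $ j = cnj (A $ j $ i))"

definition outer :: "complex ^ 'n \<Rightarrow> complex ^ 'n \<Rightarrow> complex ^ 'n ^ 'n"  \<comment> \<open>\<open>v w\<^sup>H\<close>\<close> where
  "outer v w = (\<chi> i j. v $ i * cnj (w $ j))"

definition herm_form :: "complex ^ 'n ^ 'n \<Rightarrow> complex ^ 'n \<Rightarrow> complex"  \<comment> \<open>\<open>w\<^sup>H A w\<close>\<close> where
  "herm_form A w = (\<Sum>i\<in>UNIV. cnj (w $ i) * (A *v w) $ i)"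

definition Diag :: "complex ^ 'n \<Rightarrow> complex ^ 'n ^ 'n" where
  "Diag v = (\<chi> i j. if i = j then v $ i else 0)"

definition diag_of :: "complex ^ 'n ^ 'n \<Rightarrow> complex ^ 'n" where
  "diag_of M = (\<chi> i. M $ i $ i)"

text \<open>The entrywise modulus and the entrywise real part stay in the complex type, so that they
  can be combined with complex matrices.\<close>

definition abs_vec :: "complex ^ 'n \<Rightarrow> complex ^ 'n" where
  "abs_vec v = (\<chi> i. of_real (cmod (v $ i)))"

definition Re_mat :: "complex ^ 'n ^ 'n \<Rightarrow> complex ^ 'n ^ 'n" where
  "Re_mat M = (\<chi> i j. of_real (Re (M $ i $ j)))"

text \<open>The library's \<open>infnorm\<close> treats real and imaginary parts as separate coordinates,
  so it is not the maximum of the moduli.\<close>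

definition linf_norm :: "complex ^ 'n \<Rightarrow> real" where
  "linf_norm v = Max (range (\<lambda>i. cmod (v $ i)))"

definition op_norm :: "complex ^ 'n ^ 'n \<Rightarrow> real" where
  "op_norm A = onorm (\<lambda>v. A *v v)"

text \<open>\<open>norm\<close> on \<^typ>\<open>complex ^ 'n\<close> is the Euclidean norm; the infimum is attained, see
  \<open>d2_attained\<close>.\<close>

definition d2 :: "complex ^ 'n \<Rightarrow> complex ^ 'n \<Rightarrow> real" where
  "d2 w z = (INF \<theta>\<in>{0..<2 * pi}. norm (w - cis \<theta> *s z))"

definition S_mat :: "complex ^ 'n ^ 'n \<Rightarrow> complex ^ 'n \<Rightarrow> complex ^ 'n ^ 'n" where
  "S_mat C z = Re_mat (Diag (diag_of (C ** outer z z))) - C"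

definition torus_tangent :: "complex ^ 'n \<Rightarrow> (complex ^ 'n) set" where
  "torus_tangent z = {w. \<forall>i. Re (w $ i * cnj (z $ i)) = 0}"

text \<open>Second-order critical points of the maximisation of \<^term>\<open>herm_form C w\<close> over
  \<^term>\<open>w \<in> torus\<close>. Taking \<^term>\<open>Re\<close> loses nothing, since for hermitian
  \<^term>\<open>C\<close> the form is real, see \<open>herm_form_S_mat_real\<close>.\<close>

definition second_order_critical :: "complex ^ 'n ^ 'n \<Rightarrow> complex ^ 'n \<Rightarrow> bool" where
  "second_order_critical C z \<longleftrightarrow> z \<in> torus \<and> S_mat C z *v z = 0 \<and>
     (\<forall>w\<in>torus_tangent z. 0 \<le> Re (herm_form (S_mat C z) w))"

definition Sigma_mat :: "complex ^ 'n ^ 'n \<Rightarrow> complex ^ 'n \<Rightarrow> complex ^ 'n ^ 'n" where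
  "Sigma_mat Ct z = Diag (abs_vec (Ct *v z)) - Ct"

definition rho :: "complex ^ 'n ^ 'n \<Rightarrow> complex ^ 'n \<Rightarrow> real" where
  "rho Ct z = norm (Sigma_mat Ct z *v z)"

lemma d2_attained:
  "\<exists>\<theta>\<in>{0..<2 * pi}. d2 w z = norm (w - cis \<theta> *s z) \<and>
     (\<forall>\<phi>\<in>{0..<2 * pi}. norm (w - cis \<theta> *s z) \<le> norm (w - cis \<phi> *s z))"
proof -
  let ?f = "\<lambda>\<theta>. norm (w - cis \<theta> *s z)"
  have "continuous_on {0..2 * pi} (\<lambda>\<theta>. cis \<theta> *s z)"
    unfolding vector_scalar_mult_def by (intro continuous_intros)
  then have "continuous_on {0..2 * pi} ?f"
    by (intro continuous_intros)
  then obtain t where t: "t \<in> {0..2 * pi}" "\<And>p. p \<in> {0..2 * pi} \<Longrightarrow> ?f t \<le> ?f p"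
    using continuous_attains_inf[of "{0..2 * pi}" ?f] by auto
  define s where "s = (if t = 2 * pi then 0 else t)"
  have s: "s \<in> {0..<2 * pi}" "?f s = ?f t"
    using t(1) by (auto simp: s_def)
  have min: "?f s \<le> ?f p" if "p \<in> {0..<2 * pi}" for p
    using t(2)[of p] that s(2) by auto
  have "d2 w z = ?f s"
    unfolding d2_def by (rule cInf_eq_minimum) (use s(1) min in auto)
  with s(1) min show ?thesis by auto
qed

lemma herm_form_S_mat_real:
  assumes "hermitian C"
  shows "Im (herm_form (S_mat C z) w) = 0"
proof -
  let ?S = "S_mat C z"
  have S: "?S $ i $ j = cnj (?S $ j $ i)" for i j
  proof -
    have "C $ i $ j = cnj (C $ j $ i)"
      using assms unfolding hermitian_def by blast
    then show ?thesis
      by (simp add: S_mat_def Re_mat_def Diag_def)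
  qed
  have "cnj (herm_form ?S w) = (\<Sum>i\<in>UNIV. \<Sum>j\<in>UNIV. w $ i * (cnj (?S $ i $ j) * cnj (w $ j)))"
    by (simp add: herm_form_def matrix_vector_mult_def sum_distrib_left)
  also have "\<dots> = (\<Sum>j\<in>UNIV. \<Sum>i\<in>UNIV. w $ i * (cnj (?S $ i $ j) * cnj (w $ j)))"
    by (rule sum.swap)
  also have "\<dots> = herm_form ?S w"
    unfolding S[symmetric]
    by (simp add: herm_form_def matrix_vector_mult_def sum_distrib_left mult_ac)
  finally show ?thesis
    by (metis Reals_cnj_iff complex_is_Real_iff)
qed

end

theory Submission
  imports Defs
begin

text \<open>At a second-order critical point \<open>y\<close> one has \<open>C y = Diag l y\<close> with \<open>l\<close> real and nonnegative.
  Testing the second-order condition in the directions \<open>\<i> a\<^sub>i y\<^sub>i\<close> with \<open>a\<^sub>i\<close> the real, respectively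
  imaginary part of \<open>cnj (zs\<^sub>i) y\<^sub>i\<close> and adding up gives \<open>|zs\<^sup>H y|\<^sup>2 \<ge> n\<^sup>2/2 - 2 \<parallel>\<Delta>\<parallel> n\<close>. Since
  \<open>l\<^sub>i y\<^sub>i = (zs\<^sup>H y) zs\<^sub>i + (\<Delta> y)\<^sub>i\<close>, this forces \<open>y\<close> to lie within \<open>4 \<parallel>\<Delta>\<parallel> / sqrt n\<close> of \<open>zs\<close> up to
  a phase, hence all \<open>l\<^sub>i\<close> are at least \<open>0.94 n\<close>.

  Now choose the phase of \<open>y\<close> so that \<open>y\<^sup>H z \<ge> 0\<close> and put \<open>v = z - y\<close>. Comparing \<open>|Ct z| z - Ct z\<close> with
  \<open>|Ct y| y - Ct y = 0\<close> gives \<open>rho Ct z \<ge> (0.94 n + n/\<alpha>) \<parallel>v\<parallel> - 2 \<parallel>Ct v\<parallel>\<close>. The rank-one part of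
  \<open>Ct v\<close> is of second order, because \<open>y\<^sup>H v = - \<parallel>v\<parallel>\<^sup>2/2\<close>, and with \<open>\<parallel>v\<parallel>\<close> at most about \<open>sqrt n / 2\<close> it
  contributes only about \<open>n/4 \<parallel>v\<parallel>\<close>.\<close>

section \<open>Hermitian inner product, phases and operator norm bounds\<close>

definition hinner :: "complex ^ 'n \<Rightarrow> complex ^ 'n \<Rightarrow> complex" where
  "hinner x y = (\<Sum>i\<in>UNIV. cnj (x $ i) * y $ i)"

lemma Re_hinner: "Re (hinner x y) = x \<bullet> y"
  by (simp add: hinner_def inner_vec_def inner_complex_def)

lemma hinner_add_right: "hinner x (y + z) = hinner x y + hinner x z"
  by (simp add: hinner_def distrib_left sum.distrib)

lemma hinner_diff_right: "hinner x (y - z) = hinner x y - hinner x z"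
  by (simp add: hinner_def right_diff_distrib sum_subtractf)

lemma hinner_diff_left: "hinner (x - y) z = hinner x z - hinner y z"
  by (simp add: hinner_def left_diff_distrib sum_subtractf)

lemma hinner_smult_right: "hinner x (c *s y) = c * hinner x y"
  by (simp add: hinner_def sum_distrib_left mult_ac)

lemma hinner_smult_left: "hinner (c *s x) y = cnj c * hinner x y"
  by (simp add: hinner_def sum_distrib_left mult_ac)

lemma cnj_hinner: "cnj (hinner x y) = hinner y x"
  by (simp add: hinner_def mult_ac)

lemma norm_sq_vec: "(norm (x :: complex ^ 'n))\<^sup>2 = (\<Sum>i\<in>UNIV. (cmod (x $ i))\<^sup>2)"
  by (simp add: norm_vec_def L2_set_def sum_nonneg)

lemma hinner_self: "hinner x x = of_real ((norm x)\<^sup>2)"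
  by (simp add: hinner_def norm_sq_vec complex_norm_square mult.commute del: of_real_power)

lemma norm_smult: "norm (c *s (x :: complex ^ 'n)) = cmod c * norm x"
proof (rule power2_eq_imp_eq)
  show "(norm (c *s x))\<^sup>2 = (cmod c * norm x)\<^sup>2"
    by (simp add: norm_sq_vec norm_mult power_mult_distrib sum_distrib_left)
qed auto

lemma cnj_mult_unit: "cmod u = 1 \<Longrightarrow> cnj u * u = 1"
  by (metis complex_norm_square mult.commute of_real_1 one_power2)

lemma phase_exists:
  obtains u :: complex where "cmod u = 1" "h = of_real (cmod h) * u"
proof (cases "h = 0")
  case True
  then show ?thesis using that[of 1] by simp
next
  case False
  then show ?thesis using that[of "h / of_real (cmod h)"] by (simp add: norm_divide)
qed

text \<open>The complex Cauchy-Schwarz inequality follows from the real one: rotating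
  \<open>x\<close> by the phase of \<open>hinner x y\<close> makes the product real and nonnegative
  without changing \<open>norm x\<close>.\<close>

lemma cmod_hinner_le: "cmod (hinner x y) \<le> norm x * norm y"
proof -
  obtain u where u: "cmod u = 1" "hinner x y = of_real (cmod (hinner x y)) * u"
    by (rule phase_exists)
  have "cnj u * u = 1"
    using u(1) by (rule cnj_mult_unit)
  then have "hinner (u *s x) y = of_real (cmod (hinner x y))"
    by (subst hinner_smult_left, subst u(2)) (simp add: mult_ac)
  then have "cmod (hinner x y) = (u *s x) \<bullet> y"
    by (metis Re_complex_of_real Re_hinner)
  also have "\<dots> \<le> norm (u *s x) * norm y"
    by (rule norm_cauchy_schwarz)
  finally show ?thesis by (simp add: norm_smult u(1))
qed

lemma outer_mult_vec: "outer v w *v x = hinner w x *s v"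
  by (simp add: vec_eq_iff outer_def matrix_vector_mult_def hinner_def sum_distrib_left
      sum_distrib_right mult_ac)

lemma matrix_vector_mult_smult: "(A :: complex ^ 'n ^ 'm) *v (c *s x) = c *s (A *v x)"
  by (simp add: vec_eq_iff matrix_vector_mult_def sum_distrib_left mult_ac)

lemma norm_matrix_vector_le: "norm (A *v x) \<le> op_norm A * norm x"
proof -
  have "linear (\<lambda>v. A *v v)"
    by (rule linearI)
      (simp_all add: matrix_vector_right_distrib, simp add: vec_eq_iff matrix_vector_mult_def scaleR_sum_right)
  then show ?thesis
    unfolding op_norm_def by (intro onorm) (simp add: linear_conv_bounded_linear)
qed

lemma cmod_hinner_matrix_le: "cmod (hinner w (A *v w)) \<le> op_norm A * (norm w)\<^sup>2"
proof -
  have "cmod (hinner w (A *v w)) \<le> norm w * norm (A *v w)"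
    by (rule cmod_hinner_le)
  also have "\<dots> \<le> norm w * (op_norm A * norm w)"
    by (intro mult_left_mono norm_matrix_vector_le) auto
  finally show ?thesis by (simp add: power2_eq_square mult_ac)
qed

section \<open>Geometry of the torus and the distance up to phase\<close>

lemma torus_cnj: "z \<in> torus \<Longrightarrow> cnj (z $ i) * z $ i = 1"
  by (rule cnj_mult_unit) (simp add: torus_def)

lemma norm_torus: "(z :: complex ^ 'n) \<in> torus \<Longrightarrow> (norm z)\<^sup>2 = real CARD('n)"
  by (simp add: norm_sq_vec torus_def)

lemma smult_torus: "cmod u = 1 \<Longrightarrow> z \<in> torus \<Longrightarrow> u *s z \<in> torus"
  by (simp add: torus_def norm_mult)

lemma norm_diff_torus:
  fixes x y :: "complex ^ 'n"
  assumes "x \<in> torus" "y \<in> torus"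
  shows "(norm (x - y))\<^sup>2 = 2 * real CARD('n) - 2 * Re (hinner x y)"
proof -
  have "(norm (x - y))\<^sup>2 = (norm x)\<^sup>2 + (norm y)\<^sup>2 - 2 * (x \<bullet> y)"
    by (simp add: power2_norm_eq_inner inner_diff inner_commute)
  then show ?thesis using assms by (simp add: norm_torus Re_hinner)
qed

lemma d2_le:
  assumes "cmod u = 1"
  shows "d2 w z \<le> norm (w - u *s z)"
proof -
  \<comment> \<open>\<open>Arg2pi\<close> takes its values in exactly the half-open range over which
    \<open>d2\<close> takes its infimum.\<close>
  have u: "u = cis (Arg2pi u)"
    using complex_norm_eq_1_exp[of u] assms by (metis cis_conv_exp)
  show ?thesis
    unfolding d2_def
  proof (rule cINF_lower2)
    show "bdd_below ((\<lambda>\<theta>. norm (w - cis \<theta> *s z)) ` {0..<2 * pi})"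
      by (rule bdd_belowI[of _ 0]) auto
    show "Arg2pi u \<in> {0..<2 * pi}"
      using Arg2pi[of u] by auto
    show "norm (w - cis (Arg2pi u) *s z) \<le> norm (w - u *s z)"
      using u by simp
  qed
qed

section \<open>Second-order critical points\<close>

lemma Diag_mult_vec: "(Diag d *v w) $ i = d $ i * w $ i"
  by (simp add: matrix_vector_mult_def Diag_def if_distribR if_distrib cong: if_cong)

lemma S_mat_mult:
  fixes C :: "complex ^ 'n ^ 'n"
  shows "(S_mat C z *v w) $ i = of_real (Re ((C *v z) $ i * cnj (z $ i))) * w $ i - (C *v w) $ i"
proof -
  have "diag_of (C ** outer z z) $ i = (C *v z) $ i * cnj (z $ i)"
    by (simp add: diag_of_def matrix_matrix_mult_def outer_def matrix_vector_mult_def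
        sum_distrib_left mult_ac)
  moreover have "Re_mat (Diag d) = Diag (\<chi> i. of_real (Re (d $ i)))" for d :: "complex ^ 'n"
    by (simp add: vec_eq_iff Re_mat_def Diag_def)
  ultimately show ?thesis
    by (simp add: S_mat_def matrix_vector_mult_diff_rdistrib Diag_mult_vec)
qed

text \<open>The multipliers are the real parts of \<open>(C *v z) $ i * cnj (z $ i)\<close>, the
  diagonal part of \<open>S_mat C z\<close>. The vectors with entries
  \<open>\<i> * a i * z $ i\<close>, \<open>a\<close> real, are tangent at \<open>z\<close> and have
  moduli \<open>\<bar>a i\<bar>\<close>, so the second-order condition becomes an inequality between
  real quadratic forms in \<open>a\<close>.\<close>

lemma second_order_critical_multiplier:
  fixes C :: "complex ^ 'n ^ 'n"
  assumes crit: "second_order_critical C z"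
  obtains l :: "'n \<Rightarrow> real" where
    "\<And>i. (C *v z) $ i = of_real (l i) * z $ i"
    "\<And>i. Re (C $ i $ i) \<le> l i"
    "\<And>a :: 'n \<Rightarrow> real. Re (hinner (\<chi> i. \<i> * of_real (a i) * z $ i) (C *v (\<chi> i. \<i> * of_real (a i) * z $ i)))
       \<le> (\<Sum>i\<in>UNIV. l i * (a i)\<^sup>2)"
proof -
  define l where "l i = Re ((C *v z) $ i * cnj (z $ i))" for i
  have z: "z \<in> torus" and S0: "S_mat C z *v z = 0"
    and S2: "\<And>w. w \<in> torus_tangent z \<Longrightarrow> 0 \<le> Re (herm_form (S_mat C z) w)"
    using crit by (auto simp: second_order_critical_def)
  have eig: "(C *v z) $ i = of_real (l i) * z $ i" for i
    using S_mat_mult[of C z z i] by (simp add: S0 l_def)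
  have quad: "Re (hinner (\<chi> i. \<i> * of_real (a i) * z $ i) (C *v (\<chi> i. \<i> * of_real (a i) * z $ i)))
       \<le> (\<Sum>i\<in>UNIV. l i * (a i)\<^sup>2)" for a :: "'n \<Rightarrow> real"
  proof -
    define w where "w = (\<chi> i. \<i> * of_real (a i) * z $ i)"
    have cw: "cnj (w $ i) * w $ i = of_real ((a i)\<^sup>2)" for i
    proof -
      have "cnj (w $ i) * w $ i = (cnj \<i> * \<i>) * (of_real ((a i)\<^sup>2) * (cnj (z $ i) * z $ i))"
        by (simp add: w_def power2_eq_square mult_ac del: complex_cnj_i)
      then show ?thesis by (simp add: torus_cnj[OF z])
    qed
    have "w $ i * cnj (z $ i) = \<i> * of_real (a i) * (cnj (z $ i) * z $ i)" for i
      by (simp add: w_def)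
    then have "Re (w $ i * cnj (z $ i)) = 0" for i
      by (simp only: torus_cnj[OF z]) simp
    then have "w \<in> torus_tangent z"
      unfolding torus_tangent_def by blast
    then have "0 \<le> Re (herm_form (S_mat C z) w)"
      by (rule S2)
    also have "herm_form (S_mat C z) w =
      (\<Sum>i\<in>UNIV. of_real (l i) * (cnj (w $ i) * w $ i)) - hinner w (C *v w)"
      by (simp add: herm_form_def hinner_def S_mat_mult l_def right_diff_distrib sum_subtractf mult_ac)
    also have "(\<Sum>i\<in>UNIV. of_real (l i) * (cnj (w $ i) * w $ i)) = of_real (\<Sum>i\<in>UNIV. l i * (a i)\<^sup>2)"
      by (simp add: cw)
    finally show ?thesis by (simp add: w_def)
  qed
  have "Re (C $ i $ i) \<le> l i" for i
  proof -
    \<comment> \<open>A direction supported on the single coordinate \<open>i\<close> reduces the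
      quadratic inequality to a bound on one diagonal entry.\<close>
    define a :: "'n \<Rightarrow> real" where "a j = (if j = i then 1 else 0)" for j
    define w where "w = (\<chi> j. \<i> * of_real (a j) * z $ j)"
    have w: "w $ j = (if j = i then \<i> * z $ i else 0)" for j
      by (simp add: w_def a_def)
    have "(C *v w) $ i = C $ i $ i * (\<i> * z $ i)"
      by (simp add: matrix_vector_mult_def w if_distrib cong: if_cong)
    then have "hinner w (C *v w) = (cnj \<i> * \<i>) * (C $ i $ i * (cnj (z $ i) * z $ i))"
      by (simp add: hinner_def w if_distrib if_distribR mult_ac del: complex_cnj_i cong: if_cong)
    then have "Re (C $ i $ i) = Re (hinner w (C *v w))"
      by (simp add: torus_cnj[OF z])
    also have "\<dots> \<le> (\<Sum>j\<in>UNIV. l j * (a j)\<^sup>2)"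
      using quad[of a] by (simp add: w_def)
    also have "\<dots> = l i"
      by (simp add: a_def if_distrib if_distribR cong: if_cong)
    finally show ?thesis .
  qed
  from eig this quad show ?thesis by (rule that)
qed

lemma second_order_critical_correlation:
  fixes zs z :: "complex ^ 'n"
  assumes zs: "zs \<in> torus" and crit: "second_order_critical (outer zs zs + \<Delta>) z"
    and n_def: "n = real CARD('n)"
  shows "n\<^sup>2 / 2 - 2 * op_norm \<Delta> * n \<le> (cmod (hinner zs z))\<^sup>2"
proof -
  have z: "z \<in> torus" using crit by (simp add: second_order_critical_def)
  obtain l :: "'n \<Rightarrow> real" where
    eig: "\<And>i. ((outer zs zs + \<Delta>) *v z) $ i = of_real (l i) * z $ i"
    and quad: "\<And>a :: 'n \<Rightarrow> real. Re (hinner (\<chi> i. \<i> * of_real (a i) * z $ i)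
        ((outer zs zs + \<Delta>) *v (\<chi> i. \<i> * of_real (a i) * z $ i))) \<le> (\<Sum>i\<in>UNIV. l i * (a i)\<^sup>2)"
    by (rule second_order_critical_multiplier[OF crit]) blast
  have form: "Re (hinner w ((outer zs zs + \<Delta>) *v w)) =
      (cmod (hinner zs w))\<^sup>2 + Re (hinner w (\<Delta> *v w))" for w
  proof -
    have "hinner w ((outer zs zs + \<Delta>) *v w) = hinner zs w * cnj (hinner zs w) + hinner w (\<Delta> *v w)"
      by (simp add: matrix_vector_mult_add_rdistrib hinner_add_right outer_mult_vec
          hinner_smult_right cnj_hinner)
    then show ?thesis by (simp flip: complex_norm_square)
  qed
  have noise: "\<bar>Re (hinner w (\<Delta> *v w))\<bar> \<le> op_norm \<Delta> * (norm w)\<^sup>2" for w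
    using cmod_hinner_matrix_le[of w \<Delta>] abs_Re_le_cmod order_trans by blast
  define y where "y i = cnj (zs $ i) * z $ i" for i
  define a where "a i = Re (y i)" for i
  define b where "b i = Im (y i)" for i
  have ab: "(a i)\<^sup>2 + (b i)\<^sup>2 = 1" for i
  proof -
    have "cmod (y i) = 1" using z zs by (simp add: y_def norm_mult torus_def)
    then show ?thesis by (metis a_def b_def cmod_power2 one_power2)
  qed
  define dir where "dir f = (\<chi> i. \<i> * of_real (f i) * z $ i)" for f :: "'n \<Rightarrow> real"
  have norm_dir: "(norm (dir f))\<^sup>2 = (\<Sum>i\<in>UNIV. (f i)\<^sup>2)" for f
    using z by (simp add: norm_sq_vec dir_def norm_mult torus_def)
  have hdir: "hinner zs (dir f) = \<i> * (\<Sum>i\<in>UNIV. of_real (f i) * y i)" for f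
    by (simp add: hinner_def dir_def y_def sum_distrib_left mult_ac)
  have cdir: "(cmod (hinner zs (dir f)))\<^sup>2 = (\<Sum>i\<in>UNIV. f i * a i)\<^sup>2 + (\<Sum>i\<in>UNIV. f i * b i)\<^sup>2" for f
    by (simp add: hdir norm_mult cmod_power2 a_def b_def)
  have sum1: "(\<Sum>i\<in>UNIV. (a i)\<^sup>2) + (\<Sum>i\<in>UNIV. (b i)\<^sup>2) = n"
    by (simp add: ab n_def flip: sum.distrib)
  \<comment> \<open>The multipliers sum to the objective value at \<open>z\<close>, which brings the
    correlation with \<open>zs\<close> into the estimate.\<close>
  have "hinner z ((outer zs zs + \<Delta>) *v z) = (\<Sum>i\<in>UNIV. of_real (l i) * (cnj (z $ i) * z $ i))"
    unfolding hinner_def eig by (simp add: mult_ac)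
  also have "\<dots> = of_real (\<Sum>i\<in>UNIV. l i)"
    by (simp add: torus_cnj[OF z])
  finally have "(\<Sum>i\<in>UNIV. l i) = (cmod (hinner zs z))\<^sup>2 + Re (hinner z (\<Delta> *v z))"
    using form[of z] by simp
  moreover have "(\<Sum>i\<in>UNIV. l i) = (\<Sum>i\<in>UNIV. l i * (a i)\<^sup>2) + (\<Sum>i\<in>UNIV. l i * (b i)\<^sup>2)"
    by (simp add: ab flip: sum.distrib distrib_left)
  \<comment> \<open>By \<open>ab\<close>, adding the inequalities for \<open>a\<close> and
    \<open>b\<close> gives \<open>\<Sum>i. l i\<close> on the right. The noise terms of these two
    directions together cost only \<open>op_norm \<Delta> * n\<close>, since their squared norms add
    up to \<open>n\<close>; the second \<open>op_norm \<Delta> * n\<close> comes from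
    \<open>z\<close> itself.\<close>
  moreover have "(cmod (hinner zs (dir f)))\<^sup>2 + Re (hinner (dir f) (\<Delta> *v dir f)) \<le> (\<Sum>i\<in>UNIV. l i * (f i)\<^sup>2)"
    for f using quad[of f] form by (simp add: dir_def)
  note this[of a] this[of b]
  moreover have "\<bar>Re (hinner (dir a) (\<Delta> *v dir a))\<bar> + \<bar>Re (hinner (dir b) (\<Delta> *v dir b))\<bar> \<le> op_norm \<Delta> * n"
    using noise[of "dir a"] noise[of "dir b"] unfolding norm_dir sum1[symmetric]
    by (simp add: distrib_left)
  moreover have "\<bar>Re (hinner z (\<Delta> *v z))\<bar> \<le> op_norm \<Delta> * n"
    using noise[of z] by (simp add: norm_torus[OF z] n_def)
  moreover have "n\<^sup>2 / 2 \<le> (cmod (hinner zs (dir a)))\<^sup>2 + (cmod (hinner zs (dir b)))\<^sup>2"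
  proof -
    \<comment> \<open>Only the diagonal squares \<open>A\<^sup>2\<close> and
      \<open>B\<^sup>2\<close> are kept, the mixed sums of \<open>a i * b i\<close> being discarded
      as squares. As \<open>A + B = n\<close>, the worst case is \<open>A = B\<close>.\<close>
    define A B where "A = (\<Sum>i\<in>UNIV. (a i)\<^sup>2)" and "B = (\<Sum>i\<in>UNIV. (b i)\<^sup>2)"
    have "n\<^sup>2 / 2 = A\<^sup>2 + B\<^sup>2 - (A - B)\<^sup>2 / 2"
      using sum1 by (auto simp: A_def B_def power2_eq_square algebra_simps field_simps)
    also have "\<dots> \<le> A\<^sup>2 + B\<^sup>2" by simp
    also have "\<dots> \<le> (cmod (hinner zs (dir a)))\<^sup>2 + (cmod (hinner zs (dir b)))\<^sup>2"
      unfolding cdir by (simp add: A_def B_def power2_eq_square)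
    finally show ?thesis .
  qed
  ultimately show ?thesis by linarith
qed

text \<open>Comparing moduli bounds \<open>\<bar>l - r\<bar>\<close> by \<open>cmod e\<close>.
  Replacing \<open>l\<close> by \<open>r\<close> on the left of the equation therefore costs one
  further \<open>cmod e\<close>, whence the factor 2.\<close>

lemma unit_perturbation:
  fixes z c e :: complex
  assumes "cmod z = 1" "cmod c = 1" "0 \<le> l" "0 \<le> r"
    and "of_real l * z = of_real r * c + e"
  shows "r * cmod (z - c) \<le> 2 * cmod e"
proof -
  have "\<bar>l - r\<bar> = \<bar>cmod (of_real l * z) - cmod (of_real r * c)\<bar>"
    unfolding norm_mult norm_of_real using assms(1-4) by simp
  also have "\<dots> \<le> cmod e"
    using norm_triangle_ineq3[of "of_real l * z" "of_real r * c"] assms(5) by simp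
  finally have le: "\<bar>l - r\<bar> \<le> cmod e" .
  have "of_real r * (z - c) = of_real (r - l) * z + e"
    using assms(5) by (simp add: algebra_simps)
  then have "r * cmod (z - c) = cmod (of_real (r - l) * z + e)"
    using assms(4) by (metis abs_of_nonneg norm_mult norm_of_real)
  also have "\<dots> \<le> cmod (of_real (r - l) * z) + cmod e"
    by (rule norm_triangle_ineq)
  also have "cmod (of_real (r - l) * z) = \<bar>l - r\<bar>"
    unfolding norm_mult norm_of_real using assms(1) by simp
  finally show ?thesis using le by linarith
qed

lemma second_order_critical_near_signal:
  fixes zs z :: "complex ^ 'n" and \<Delta> :: "complex ^ 'n ^ 'n"
  assumes zs: "zs \<in> torus" and crit: "second_order_critical (outer zs zs + \<Delta>) z"
    and diag: "\<forall>i. \<Delta> $ i $ i = 0" and n_def: "n = real CARD('n)"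
    and small: "op_norm \<Delta> \<le> n / 8"
  obtains u l where "cmod u = 1" "hinner zs z = of_real (cmod (hinner zs z)) * u"
    "\<And>i. ((outer zs zs + \<Delta>) *v z) $ i = of_real (l i) * z $ i" "\<And>i. 0 \<le> l i"
    "norm (z - u *s zs) \<le> 4 * op_norm \<Delta> / sqrt n"
proof -
  have z: "z \<in> torus" using crit by (simp add: second_order_critical_def)
  have n: "0 < n" by (simp add: n_def)
  obtain l :: "'n \<Rightarrow> real" where
    eig: "\<And>i. ((outer zs zs + \<Delta>) *v z) $ i = of_real (l i) * z $ i"
    and l1: "\<And>i. Re ((outer zs zs + \<Delta>) $ i $ i) \<le> l i"
    by (rule second_order_critical_multiplier[OF crit]) blast
  have l0: "0 \<le> l i" for i
  proof -
    \<comment> \<open>The diagonal of \<open>\<Delta>\<close> vanishes, so the diagonal entry is the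
      squared modulus of \<open>zs $ i\<close>.\<close>
    have "0 \<le> Re ((outer zs zs + \<Delta>) $ i $ i)"
      using diag by (simp add: outer_def)
    then show ?thesis using l1[of i] by linarith
  qed
  obtain u where u: "cmod u = 1" "hinner zs z = of_real (cmod (hinner zs z)) * u"
    by (rule phase_exists)
  define r where "r = cmod (hinner zs z)"
  \<comment> \<open>The threshold \<open>n / 8\<close> leaves
    \<open>n\<^sup>2 / 2 - n\<^sup>2 / 4\<close> in the correlation bound, which is the square of
    \<open>n / 2\<close>.\<close>
  have "op_norm \<Delta> * n \<le> n / 8 * n"
    using small n by (intro mult_right_mono) auto
  then have "(n / 2)\<^sup>2 \<le> r\<^sup>2"
    using second_order_critical_correlation[OF zs crit n_def]
    by (simp add: r_def power2_eq_square)
  then have r: "n / 2 \<le> r"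
    by (rule power2_le_imp_le) (simp add: r_def)
  have comp: "r * cmod (z $ i - u * zs $ i) \<le> 2 * cmod ((\<Delta> *v z) $ i)" for i
  proof (rule unit_perturbation)
    show "of_real (l i) * z $ i = of_real r * (u * zs $ i) + (\<Delta> *v z) $ i"
    proof -
      have "of_real (l i) * z $ i = hinner zs z * zs $ i + (\<Delta> *v z) $ i"
        using eig[of i] by (simp add: matrix_vector_mult_add_rdistrib outer_mult_vec)
      then show ?thesis
        by (subst (asm) u(2)) (simp add: r_def)
    qed
  qed (use z zs u(1) l0 in \<open>auto simp: torus_def norm_mult r_def\<close>)
  have "norm (of_real r *s (z - u *s zs)) \<le> norm ((2 :: complex) *s (\<Delta> *v z))"
    by (rule norm_le_componentwise_cart)
      (unfold vector_smult_component norm_mult, use comp in \<open>simp add: r_def\<close>)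
  then have "r * norm (z - u *s zs) \<le> 2 * norm (\<Delta> *v z)"
    unfolding norm_smult by (simp add: r_def)
  also have "\<dots> \<le> 2 * (op_norm \<Delta> * norm z)"
    using norm_matrix_vector_le[of \<Delta> z] by simp
  also have "norm z = sqrt n"
    using norm_torus[OF z] by (metis n_def norm_ge_zero real_sqrt_unique)
  finally have "n / 2 * norm (z - u *s zs) \<le> 2 * (op_norm \<Delta> * sqrt n)"
    using mult_right_mono[OF r, of "norm (z - u *s zs)"] by simp
  also have "\<dots> = n / 2 * (4 * op_norm \<Delta> / sqrt n)"
    using n by (simp add: field_simps)
  finally have "norm (z - u *s zs) \<le> 4 * op_norm \<Delta> / sqrt n"
    by (rule mult_left_le_imp_le) (use n in simp)
  with u eig l0 show ?thesis by (intro that)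
qed

section \<open>Phase alignment and the lower bound for the residual\<close>

lemma aligned_phase:
  fixes z y :: "complex ^ 'n"
  assumes z: "z \<in> torus" and y: "y \<in> torus"
  obtains c where "cmod c = 1" "\<And>b. cmod b = 1 \<Longrightarrow> norm (z - c *s y) \<le> norm (z - b *s y)"
    "hinner (c *s y) (z - c *s y) = - of_real ((norm (z - c *s y))\<^sup>2 / 2)"
proof -
  \<comment> \<open>The phase of \<open>hinner y z\<close> makes the product of
    \<open>c *s y\<close> with \<open>z\<close> real and as large as possible, which on the torus
    means smallest distance.\<close>
  obtain c where c: "cmod c = 1" "hinner y z = of_real (cmod (hinner y z)) * c"
    by (rule phase_exists)
  define h where "h = cmod (hinner y z)"
  have "cnj c * c = 1"
    using c(1) by (rule cnj_mult_unit)
  then have hc: "hinner (c *s y) z = of_real h"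
    by (subst hinner_smult_left, subst c(2)) (simp add: h_def mult_ac)
  have sq: "(norm (z - b *s y))\<^sup>2 = 2 * real CARD('n) - 2 * Re (hinner (b *s y) z)" if "cmod b = 1" for b
    using norm_diff_torus[OF smult_torus[OF that y] z] by (simp add: norm_minus_commute)
  have "norm (z - c *s y) \<le> norm (z - b *s y)" if "cmod b = 1" for b
  proof (rule power2_le_imp_le)
    have "Re (hinner (b *s y) z) \<le> cmod (hinner (b *s y) z)"
      by (rule complex_Re_le_cmod)
    also have "\<dots> = h"
      by (simp add: hinner_smult_left norm_mult that h_def)
    finally show "(norm (z - c *s y))\<^sup>2 \<le> (norm (z - b *s y))\<^sup>2"
      by (simp add: sq c(1) that hc)
  qed auto
  moreover have "hinner (c *s y) (z - c *s y) = - of_real ((norm (z - c *s y))\<^sup>2 / 2)"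
    unfolding sq[OF c(1)]
    by (simp add: hinner_diff_right hc hinner_self norm_torus smult_torus c(1) y
        diff_divide_distrib)
  ultimately show ?thesis using c(1) by (rule that[rotated])
qed

text \<open>With \<open>t = A *v (z - y)\<close> one has \<open>A *v z = m y + t\<close> entrywise.
  Replacing the modulus of \<open>(A *v z) $ i\<close> by \<open>m i\<close> costs at most
  \<open>cmod (t $ i)\<close>, and replacing \<open>A *v z\<close> by \<open>m y\<close> costs the
  same again, so the residual is \<open>m (z - y)\<close> up to twice \<open>t\<close>.\<close>

lemma rho_lower_bound:
  fixes z y :: "complex ^ 'n"
  assumes z: "z \<in> torus" and y: "y \<in> torus"
    and eig: "\<And>i. (A *v y) $ i = of_real (m i) * y $ i" and K: "\<And>i. K \<le> m i" "0 \<le> K"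
  shows "K * norm (z - y) \<le> rho A z + 2 * norm (A *v (z - y))"
proof -
  define s where "s = Sigma_mat A z *v z"
  define t where "t = A *v (z - y)"
  have Az: "(A *v z) $ i = of_real (m i) * y $ i + t $ i" for i
    by (simp add: t_def matrix_vector_mult_diff_distrib eig)
  have s: "s $ i = of_real (cmod ((A *v z) $ i)) * z $ i - (A *v z) $ i" for i
    by (simp add: s_def Sigma_mat_def matrix_vector_mult_diff_rdistrib Diag_mult_vec abs_vec_def)
  have comp: "K * cmod ((z - y) $ i) \<le> cmod (s $ i) + 2 * cmod (t $ i)" for i
  proof -
    have mi: "0 \<le> m i" using K(1)[of i] K(2) by linarith
    have zi: "cmod (z $ i) = 1" and yi: "cmod (y $ i) = 1"
      using z y by (auto simp: torus_def)
    have "m i = cmod (of_real (m i) * y $ i)"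
      unfolding norm_mult norm_of_real using mi yi by simp
    then have "\<bar>m i - cmod ((A *v z) $ i)\<bar> \<le> cmod (t $ i)"
      using norm_triangle_ineq3[of "of_real (m i) * y $ i" "(A *v z) $ i"] Az[of i]
      by (simp add: norm_minus_commute)
    then have "cmod (of_real (m i - cmod ((A *v z) $ i)) * z $ i) \<le> cmod (t $ i)"
      unfolding norm_mult norm_of_real zi by simp
    moreover have "of_real (m i) * (z - y) $ i =
        of_real (m i - cmod ((A *v z) $ i)) * z $ i + s $ i + t $ i"
      unfolding s Az by (simp add: algebra_simps)
    then have "cmod (of_real (m i) * (z - y) $ i) \<le>
        cmod (of_real (m i - cmod ((A *v z) $ i)) * z $ i) + cmod (s $ i) + cmod (t $ i)"
      by (simp only: norm_triangle_le norm_triangle_ineq add_right_mono)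
    moreover have "K * cmod ((z - y) $ i) \<le> m i * cmod ((z - y) $ i)"
      using K(1) by (rule mult_right_mono) simp
    then have "K * cmod ((z - y) $ i) \<le> cmod (of_real (m i) * (z - y) $ i)"
      unfolding norm_mult norm_of_real using mi by simp
    ultimately show ?thesis by linarith
  qed
  \<comment> \<open>Vectors of moduli turn the entrywise bound into a triangle inequality for
    Euclidean norms.\<close>
  define P where "P = (\<chi> i. cmod (s $ i))"
  define Q where "Q = (\<chi> i. cmod (t $ i))"
  have "norm (of_real K *s (z - y)) \<le> norm (P + 2 *\<^sub>R Q)"
  proof (rule norm_le_componentwise_cart)
    fix i
    have "norm ((of_real K *s (z - y)) $ i) = K * cmod ((z - y) $ i)"
      unfolding vector_smult_component norm_mult norm_of_real using K(2) by simp
    also have "\<dots> \<le> (P + 2 *\<^sub>R Q) $ i"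
      using comp[of i] by (simp add: P_def Q_def)
    finally show "norm ((of_real K *s (z - y)) $ i) \<le> norm ((P + 2 *\<^sub>R Q) $ i)"
      unfolding real_norm_def by linarith
  qed
  also have "\<dots> \<le> norm P + 2 * norm Q"
    using norm_triangle_ineq[of P "2 *\<^sub>R Q"] by simp
  also have "norm P = rho A z"
    by (simp add: P_def s_def rho_def norm_vec_def)
  also have "norm Q = norm t"
    by (simp add: Q_def norm_vec_def)
  finally show ?thesis
    unfolding norm_smult norm_of_real t_def using K(2) by simp
qed

section \<open>The error bound\<close>

lemma cmod_le_linf_norm: "cmod (v $ i) \<le> linf_norm v"
  unfolding linf_norm_def by (rule Max_ge) auto

lemma mat_mult_vec: "mat c *v x = c *s (x :: complex ^ 'n)"
proof -
  have "mat c = Diag (\<chi> i. c)"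
    by (simp add: vec_eq_iff mat_def Diag_def)
  then have "mat c *v x = Diag (\<chi> i. c) *v x"
    by (rule arg_cong)
  then show ?thesis by (simp add: vec_eq_iff Diag_mult_vec)
qed

theorem proposition4:
  fixes zs :: "complex ^ 'n" and \<Delta> C Ct :: "complex ^ 'n ^ 'n" and \<alpha> n :: real
  assumes n_def: "n = real CARD('n)"
    and "zs \<in> torus"
    and "hermitian \<Delta>" and "\<forall>i. \<Delta> $ i $ i = 0"
    and C_def: "C = outer zs zs + \<Delta>"
    and "op_norm \<Delta> \<le> n powr (2 / 3) / 32768"
    and "linf_norm (\<Delta> *v zs) \<le> n / 24"
    and "\<alpha> \<ge> 4"
    and Ct_def: "Ct = C + mat (of_real (n / \<alpha>))"
  shows "\<forall>z zt. z \<in> torus \<longrightarrow> d2 z zs \<le> sqrt n / 2 \<longrightarrow> second_order_critical C zt \<longrightarrow>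
           d2 z zt \<le> 8 / n * rho Ct z"
proof (intro allI impI)
  fix z zt :: "complex ^ 'n"
  assume z: "z \<in> torus" and close: "d2 z zs \<le> sqrt n / 2" and crit: "second_order_critical C zt"
  note zs = \<open>zs \<in> torus\<close>
  have zt: "zt \<in> torus" using crit by (simp add: second_order_critical_def)
  have n1: "1 \<le> n" by (simp add: n_def Suc_le_eq)
  have norm_n: "norm x = sqrt n" if "x \<in> torus" for x :: "complex ^ 'n"
    using norm_torus[OF that] by (metis n_def norm_ge_zero real_sqrt_unique)
  define \<delta> where "\<delta> = op_norm \<Delta>"
  have "0 \<le> \<delta> * norm zs"
    using norm_matrix_vector_le[of \<Delta> zs] norm_ge_zero[of "\<Delta> *v zs"] unfolding \<delta>_def by linarith
  then have delta_nonneg: "0 \<le> \<delta>"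
    using n1 by (simp add: norm_n zs zero_le_mult_iff)
  have delta_le: "\<delta> \<le> n / 32768"
  proof -
    have "n powr (2 / 3) \<le> n powr 1"
      using n1 by (intro powr_mono) auto
    then show ?thesis using assms(6) n1 by (simp add: \<delta>_def)
  qed
  \<comment> \<open>The exponent 2/3 enters here: squared it gives 4/3, which is below 3/2. The
    constant is \<open>32768 = 2 ^ 15\<close> squared.\<close>
  have delta_sq_le: "\<delta>\<^sup>2 / sqrt n \<le> n / 2 ^ 30"
  proof -
    have "\<delta>\<^sup>2 \<le> (n powr (2 / 3) / 32768)\<^sup>2"
      using assms(6) delta_nonneg by (intro power_mono) (auto simp: \<delta>_def)
    also have "\<dots> = n powr (4 / 3) / 2 ^ 30"
      by (simp add: power_divide power2_eq_square flip: powr_add)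
    also have "\<dots> \<le> n powr (1 + 1 / 2) / 2 ^ 30"
      using n1 by (intro divide_right_mono powr_mono) auto
    also have "\<dots> = n * sqrt n / 2 ^ 30"
      using n1 unfolding powr_add by (simp add: powr_half_sqrt)
    finally show ?thesis using n1 by (simp add: field_simps)
  qed
  obtain u l where u: "cmod u = 1" "hinner zs zt = of_real (cmod (hinner zs zt)) * u"
    and eig: "\<And>i. (C *v zt) $ i = of_real (l i) * zt $ i" and l0: "\<And>i. 0 \<le> l i"
    and e: "norm (zt - u *s zs) \<le> 4 * \<delta> / sqrt n"
  proof (rule second_order_critical_near_signal[OF zs crit[unfolded C_def] assms(4) n_def])
    show "op_norm \<Delta> \<le> n / 8"
      using delta_le n1 by (simp add: \<delta>_def)
  qed (auto simp: \<delta>_def C_def intro: that)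
  define \<epsilon> where "\<epsilon> = norm (zt - u *s zs)"
  have e_sqrt: "\<epsilon> * sqrt n \<le> n / 8192"
  proof -
    have "\<epsilon> * sqrt n \<le> 4 * \<delta>"
      using e n1 by (simp add: \<epsilon>_def field_simps)
    then show ?thesis using delta_le by simp
  qed
  have e_sq: "\<epsilon>\<^sup>2 \<le> n / 1000"
  proof -
    have "\<epsilon>\<^sup>2 * n = (\<epsilon> * sqrt n)\<^sup>2" using n1 by (simp add: power_mult_distrib)
    also have "\<dots> \<le> (n / 8192)\<^sup>2"
      using e_sqrt n1 by (intro power_mono) (auto simp: \<epsilon>_def)
    also have "\<dots> \<le> n / 1000 * n"
      using n1 by (simp add: power2_eq_square field_simps)
    finally show ?thesis using n1 by simp
  qed
  \<comment> \<open>This product bounds the entries of \<open>\<Delta> *v (zt - u *s zs)\<close>.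
    Its order \<open>\<delta>\<^sup>2 / sqrt n\<close> is why \<open>delta_sq_le\<close> was
    prepared.\<close>
  have de: "\<delta> * \<epsilon> \<le> n / 1000"
  proof -
    have "\<delta> * \<epsilon> \<le> \<delta> * (4 * \<delta> / sqrt n)"
      using e delta_nonneg unfolding \<epsilon>_def by (rule mult_left_mono)
    also have "\<dots> = 4 * (\<delta>\<^sup>2 / sqrt n)" by (simp add: power2_eq_square)
    also have "\<dots> \<le> n / 1000" using delta_sq_le n1 by simp
    finally show ?thesis .
  qed
  have r: "999 / 1000 * n \<le> cmod (hinner zs zt)"
  proof -
    have "cnj u * u = 1"
    using u(1) by (rule cnj_mult_unit)
    then have "hinner (u *s zs) zt = of_real (cmod (hinner zs zt))"
      by (subst hinner_smult_left, subst u(2)) (simp add: mult_ac)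
    then have "\<epsilon>\<^sup>2 = 2 * n - 2 * cmod (hinner zs zt)"
      using norm_diff_torus[OF smult_torus[OF u(1) zs] zt]
      by (simp add: \<epsilon>_def n_def norm_minus_commute)
    then show ?thesis using e_sq n1 by simp
  qed
  \<comment> \<open>The hypothesis on \<open>\<Delta> *v zs\<close> is transferred to
    \<open>zt\<close> by splitting off \<open>u *s zs\<close>. Numerically, 0.999 - 1/24 - 0.001
    exceeds 0.94.\<close>
  have l: "94 / 100 * n \<le> l i" for i
  proof -
    have "(\<Delta> *v zt) $ i = u * (\<Delta> *v zs) $ i + (\<Delta> *v (zt - u *s zs)) $ i"
      by (simp add: matrix_vector_mult_diff_distrib matrix_vector_mult_smult)
    then have "cmod ((\<Delta> *v zt) $ i) \<le> cmod (u * (\<Delta> *v zs) $ i) + cmod ((\<Delta> *v (zt - u *s zs)) $ i)"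
      by (metis norm_triangle_ineq)
    also have "cmod (u * (\<Delta> *v zs) $ i) \<le> n / 24"
      using cmod_le_linf_norm[of "\<Delta> *v zs" i] assms(7) by (simp add: norm_mult u(1))
    also have "cmod ((\<Delta> *v (zt - u *s zs)) $ i) \<le> \<delta> * \<epsilon>"
      unfolding \<delta>_def \<epsilon>_def
      by (rule order_trans[OF Finite_Cartesian_Product.norm_nth_le norm_matrix_vector_le])
    finally have D: "cmod ((\<Delta> *v zt) $ i) \<le> n / 24 + n / 1000"
      using de by linarith
    have "of_real (l i) * zt $ i = hinner zs zt * zs $ i + (\<Delta> *v zt) $ i"
      using eig[of i] by (simp add: C_def matrix_vector_mult_add_rdistrib outer_mult_vec)
    then have "cmod (hinner zs zt * zs $ i) \<le> cmod (of_real (l i) * zt $ i) + cmod ((\<Delta> *v zt) $ i)"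
      by (metis add_diff_cancel_right' norm_triangle_ineq4)
    then have "cmod (hinner zs zt) \<le> l i + cmod ((\<Delta> *v zt) $ i)"
      unfolding norm_mult norm_of_real using zs zt l0[of i] by (simp add: torus_def)
    then show ?thesis using r D n1 by linarith
  qed
  obtain a where a: "cmod a = 1" "norm (z - a *s zs) \<le> sqrt n / 2"
    using d2_attained[of z zs] close by (metis norm_cis)
  obtain c where c: "cmod c = 1" "\<And>b. cmod b = 1 \<Longrightarrow> norm (z - c *s zt) \<le> norm (z - b *s zt)"
    and hv: "hinner (c *s zt) (z - c *s zt) = - of_real ((norm (z - c *s zt))\<^sup>2 / 2)"
    by (rule aligned_phase[OF z zt]) blast
  define y where "y = c *s zt"
  define v where "v = z - y"
  have v_le: "norm v \<le> sqrt n / 2 + \<epsilon>"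
  proof -
    \<comment> \<open>The phase \<open>a / u\<close> carries \<open>zt\<close> to within \<epsilon>
      of \<open>a *s zs\<close>; the optimal phase \<open>c\<close> does at least as well against
      \<open>z\<close>.\<close>
    have "a *s zs - (a / u) *s zt = (- (a / u)) *s (zt - u *s zs)"
      using u(1) by (auto simp: vec_eq_iff field_simps)
    then have "norm (a *s zs - (a / u) *s zt) = norm ((- (a / u)) *s (zt - u *s zs))"
      by (rule arg_cong)
    also have "\<dots> = \<epsilon>"
      unfolding norm_smult \<epsilon>_def by (simp add: norm_divide a(1) u(1))
    finally have "norm (a *s zs - (a / u) *s zt) = \<epsilon>" .
    moreover have "norm v \<le> norm (z - (a / u) *s zt)"
      unfolding v_def y_def by (rule c(2)) (simp add: norm_divide a(1) u(1))
    moreover have "norm (z - (a / u) *s zt) \<le> norm (z - a *s zs) + norm (a *s zs - (a / u) *s zt)"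
      using norm_triangle_ineq[of "z - a *s zs" "a *s zs - (a / u) *s zt"] by simp
    ultimately show ?thesis using a(2) by linarith
  qed
  have hzs: "cmod (hinner zs v) * sqrt n \<le> (n / 4 + n / 1000) * norm v"
  proof -
    \<comment> \<open>\<open>s\<close> is the rotated copy of \<open>zs\<close> at distance
      \<epsilon> from \<open>y\<close>. Against \<open>y\<close> the product with \<open>v\<close>
      is of second order by \<open>hv\<close>; moving from \<open>y\<close> to \<open>s\<close>
      costs \<open>\<epsilon> * norm v\<close>. The factor \<open>sqrt n\<close> is the norm of
      \<open>zs\<close> in the rank-one term.\<close>
    define s where "s = (c * u) *s zs"
    have "y - s = c *s (zt - u *s zs)"
      by (simp add: y_def s_def vec_eq_iff algebra_simps)
    then have ys: "norm (y - s) = \<epsilon>"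
      by (simp only: norm_smult c(1) \<epsilon>_def mult_1)
    have "cmod (hinner zs v) = cmod (hinner s v)"
      by (simp add: s_def hinner_smult_left norm_mult u(1) c(1))
    also have "hinner s v = hinner y v - hinner (y - s) v"
      by (simp add: hinner_diff_left)
    also have "cmod \<dots> \<le> cmod (hinner y v) + cmod (hinner (y - s) v)"
      by (rule norm_triangle_ineq4)
    also have "cmod (hinner y v) = (norm v)\<^sup>2 / 2"
      unfolding y_def v_def hv norm_minus_cancel norm_of_real by simp
    also have "cmod (hinner (y - s) v) \<le> \<epsilon> * norm v"
      using cmod_hinner_le[of "y - s" v] by (simp add: ys)
    also have "(norm v)\<^sup>2 / 2 \<le> (sqrt n / 2 + \<epsilon>) / 2 * norm v"
      using mult_right_mono[OF v_le, of "norm v"] by (simp add: power2_eq_square)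
    finally have "cmod (hinner zs v) \<le> (sqrt n / 4 + 3 / 2 * \<epsilon>) * norm v"
      by (simp add: field_simps)
    then have "cmod (hinner zs v) * sqrt n \<le> (sqrt n / 4 + 3 / 2 * \<epsilon>) * norm v * sqrt n"
      using n1 by (intro mult_right_mono) auto
    also have "\<dots> = (n / 4 + 3 / 2 * (\<epsilon> * sqrt n)) * norm v"
      using n1 by (simp add: algebra_simps)
    also have "\<dots> \<le> (n / 4 + n / 1000) * norm v"
      using e_sqrt n1 by (intro mult_right_mono) auto
    finally show ?thesis .
  qed
  have Ct: "Ct *v x = hinner zs x *s zs + \<Delta> *v x + of_real (n / \<alpha>) *s x" for x
    by (simp add: Ct_def C_def matrix_vector_mult_add_rdistrib outer_mult_vec mat_mult_vec)
  have na: "0 \<le> n / \<alpha>" "n / \<alpha> \<le> n / 4"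
    using n1 assms(8) divide_left_mono[of 4 \<alpha> n] by auto
  have Ctv: "norm (Ct *v v) \<le> (n / 4 + n / 500 + n / \<alpha>) * norm v"
  proof -
    have "norm (Ct *v v) \<le> norm (hinner zs v *s zs) + norm (\<Delta> *v v) + norm (of_real (n / \<alpha>) *s v)"
      unfolding Ct by (rule norm_triangle_le) (intro add_right_mono norm_triangle_ineq)
    also have "norm (hinner zs v *s zs) \<le> (n / 4 + n / 1000) * norm v"
      using hzs by (simp add: norm_smult norm_n zs)
    also have "norm (\<Delta> *v v) \<le> n / 1000 * norm v"
    proof -
      have "norm (\<Delta> *v v) \<le> \<delta> * norm v"
        unfolding \<delta>_def by (rule norm_matrix_vector_le)
      also have "\<dots> \<le> n / 1000 * norm v"
        using delta_le n1 by (intro mult_right_mono) auto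
      finally show ?thesis .
    qed
    also have "norm (of_real (n / \<alpha>) *s v) = n / \<alpha> * norm v"
      unfolding norm_smult norm_of_real abs_of_nonneg[OF na(1)] ..
    finally show ?thesis by (simp add: algebra_simps)
  qed
  \<comment> \<open>A global phase preserves the multiplier equation, and the identity shift raises
    every multiplier by \<open>n / \<alpha>\<close>.\<close>
  have "(Ct *v y) $ i = of_real (l i + n / \<alpha>) * y $ i" for i
  proof -
    have "Ct *v y = c *s (C *v zt) + of_real (n / \<alpha>) *s y"
      by (simp add: Ct_def matrix_vector_mult_add_rdistrib mat_mult_vec y_def matrix_vector_mult_smult)
    then show ?thesis using eig[of i] by (simp add: y_def algebra_simps)
  qed
  then have main: "(94 / 100 * n + n / \<alpha>) * norm v \<le> rho Ct z + 2 * norm (Ct *v v)"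
    unfolding v_def
    by (rule rho_lower_bound[OF z, rotated])
      (use l na n1 smult_torus[OF c(1) zt] in \<open>auto simp: y_def\<close>)
  have "(94 / 100 * n + n / \<alpha> - 2 * (n / 4 + n / 500 + n / \<alpha>)) * norm v \<le> rho Ct z"
  proof -
    have "(A - 2 * B) * x \<le> R" if "A * x \<le> R + 2 * N" "N \<le> B * x" for A B x R N :: real
      using that by (simp add: algebra_simps)
    from this[OF main Ctv] show ?thesis .
  qed
  \<comment> \<open>The factor on the right is \<open>0.436 * n - n / \<alpha>\<close>; since
    \<alpha> is at least 4 it is at least \<open>0.186 * n\<close>, above
    \<open>n / 8\<close>.\<close>
  moreover have "n / 8 * norm v \<le> (94 / 100 * n + n / \<alpha> - 2 * (n / 4 + n / 500 + n / \<alpha>)) * norm v"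
    using na n1 by (intro mult_right_mono) auto
  ultimately have "n / 8 * norm v \<le> rho Ct z"
    by (rule order_trans[rotated])
  then have "norm v \<le> 8 / n * rho Ct z"
    using n1 by (simp add: field_simps)
  moreover have "d2 z zt \<le> norm v"
    unfolding v_def y_def by (rule d2_le[OF c(1)])
  ultimately show "d2 z zt \<le> 8 / n * rho Ct z" by linarith
qed

end
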